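(* (Levi's theorem, Lebesgue monotone convergence theorem.) Let $\Sigma$ be an abstract $\sigma$-algebra with measure $\mu$, and let $f,f_n:\mathcal{B}\to\Sigma$ ($n\in\mathbb{N}$) be non-negative measurable functions with $f_n\nearrow f$. Then $$\lim_{n\to\infty}\int f_n\,d\mu=\int f\,d\mu.$$
   Context: An abstract $\sigma$-algebra is a Boolean algebra in which all countable joins exist. A morphism of abstract $\sigma$-algebras is a map preserving order, $0$, $1$, complements and countable joins. A measure on $\Sigma$ is a function $\mu:\Sigma\to[0,\infty]$ with $\mu(0)=0$ and $\mu(\bigvee_{i=0}^\infty a_i)=\sum_{i=0}^\infty\mu(a_i)$ whenever $a_i\wedge a_j=0$ for $i\neq j$. A $\sigma$-frame is a lattice with $0,1$, finite meets and countable joins, with finite meets distributing over countable joins. $\mathcal{B}$ denotes the universal abstract $\sigma$-algebra on the $\sigma$-frame of open subsets of $[0,\infty]$ (usual topology): every $\sigma$-frame morphism from the open sets of $[0,\infty]$ to an abstract $\sigma$-algebra $\Sigma$ extends uniquely to a morphism of abstract $\sigma$-algebras $\mathcal{B}\to\Sigma$. Open sets are regarded as elements of $\mathcal{B}$, and $[0,t]\in\mathcal{B}$ denotes the complement of $(t,\infty]$. A non-negative measurable function on $\Sigma$ is a morphism of abstract $\sigma$-algebras $f:\mathcal{B}\to\Sigma$. Write $f\le g$ if $f([0,t])\ge g([0,t])$ for every $t\in[0,\infty]$. Write $f_n\nearrow f$ if $f_0\le f_1\le f_2\le\dots\le f$ and $f([0,t])=\bigwedge_n f_n([0,t])$ for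 all $t\in[0,\infty]$. A simple function is a morphism $f:\mathcal{B}\to\Sigma$ that factors as $f=s\circ\chi$ with morphisms of abstract $\sigma$-algebras $\chi:\mathcal{B}\to 2^{\{0,\dots,n\}}$ and $s:2^{\{0,\dots,n\}}\to\Sigma$ for some $n$. Such a $\chi$ is induced by points $x_0,\dots,x_n\in[0,\infty]$ (that is, $\chi(U)=\{i: x_i\in U\}$ for $U$ open), and one sets $\int f\,d\mu=\sum_{i=0}^n\mu(s(\{i\}))\,x_i$ with $0\cdot\infty=0$. For an arbitrary non-negative measurable $f$, $\int f\,d\mu=\sup\{\int g\,d\mu: g\le f,\ g\text{ simple}\}$. *)

theory Defs
  imports "HOL-Analysis.Analysis"
begin

unbundle lattice_syntax

section \<open>Abstract sigma-algebras, morphisms and measures\<close>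

text \<open>
  A Boolean algebra with countable joins. Only the values of \<^const>\<open>Sup\<close> and \<^const>\<open>Inf\<close> on
  countable sets are constrained; countable meets come for free by complementation, so the class
  imposes nothing beyond the existence of countable joins. The degenerate algebra is allowed.
\<close>

class abstract_sigma_algebra = boolean_algebra + countable_complete_lattice

instance set :: (type) abstract_sigma_algebra ..

text \<open>
  The principal ideal \<open>{a. a \<le> d}\<close> of an abstract sigma-algebra is itself an abstract
  sigma-algebra, with greatest element \<open>d\<close>, complement \<open>\<lambda>a. d - a\<close> and the inherited countable
  joins. The following says that \<open>h\<close> is a morphism from \<open>{a. a \<le> d}\<close> to \<open>{b. b \<le> e}\<close>. For
  \<open>d = \<top>\<close> the domain is the whole algebra (and \<open>d - a = - a\<close>), and for \<open>d = {..n}\<close> of type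
  \<^typ>\<open>nat set\<close> it is the power set of \<open>{0,\<dots>,n}\<close>; the relative version makes it possible to
  quantify over \<open>n\<close>.
\<close>

definition sigma_morphism_on ::
    "'a::abstract_sigma_algebra \<Rightarrow> 'b::abstract_sigma_algebra \<Rightarrow> ('a \<Rightarrow> 'b) \<Rightarrow> bool" where
  "sigma_morphism_on d e h \<longleftrightarrow>
     (\<forall>a\<le>d. h a \<le> e) \<and>
     (\<forall>a b. a \<le> b \<longrightarrow> b \<le> d \<longrightarrow> h a \<le> h b) \<and>
     h \<bottom> = \<bottom> \<and> h d = e \<and>
     (\<forall>a\<le>d. h (d - a) = e - h a) \<and>
     (\<forall>a :: nat \<Rightarrow> 'a. (\<forall>i. a i \<le> d) \<longrightarrow> h (SUP i. a i) = (SUP i. h (a i)))"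

definition sigma_morphism ::
    "('a::abstract_sigma_algebra \<Rightarrow> 'b::abstract_sigma_algebra) \<Rightarrow> bool" where
  "sigma_morphism h \<longleftrightarrow> sigma_morphism_on \<top> \<top> h"

definition sigma_measure :: "('a::abstract_sigma_algebra \<Rightarrow> ennreal) \<Rightarrow> bool" where
  "sigma_measure \<mu> \<longleftrightarrow>
     \<mu> \<bottom> = 0 \<and>
     (\<forall>a :: nat \<Rightarrow> 'a. (\<forall>i j. i \<noteq> j \<longrightarrow> a i \<sqinter> a j = \<bottom>) \<longrightarrow> \<mu> (SUP i. a i) = (\<Sum>i. \<mu> (a i)))"

lemma sigma_morphism_onD:
  assumes "sigma_morphism_on d e h"
  shows "a \<le> d \<Longrightarrow> h a \<le> e"
    and "a \<le> b \<Longrightarrow> b \<le> d \<Longrightarrow> h a \<le> h b"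
    and "h \<bottom> = \<bottom>" "h d = e"
    and "a \<le> d \<Longrightarrow> h (d - a) = e - h a"
    and "(\<And>i::nat. A i \<le> d) \<Longrightarrow> h (SUP i. A i) = (SUP i. h (A i))"
  using assms unfolding sigma_morphism_on_def by blast+

lemma sup_conv_SUP:
  fixes a b :: "'a::countable_complete_lattice"
  shows "a \<squnion> b = (SUP i::nat. if i = 0 then a else b)"
proof (rule antisym)
  have "(if i = 0 then a else b) \<le> (SUP i::nat. if i = 0 then a else b)" for i :: nat
    by (rule ccSUP_upper) auto
  from this[of 0] this[of 1] show "a \<squnion> b \<le> (SUP i::nat. if i = 0 then a else b)"
    by simp
qed (auto intro!: ccSUP_least)

lemma sigma_morphism_on_sup:
  assumes "sigma_morphism_on d e h" "a \<le> d" "b \<le> d"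
  shows "h (a \<squnion> b) = h a \<squnion> h b"
proof -
  have "h (a \<squnion> b) = (SUP i::nat. h (if i = 0 then a else b))"
    unfolding sup_conv_SUP using assms by (intro sigma_morphism_onD(6)) auto
  also have "\<dots> = (SUP i::nat. if i = 0 then h a else h b)"
    by (simp only: if_distrib[of h])
  finally show ?thesis by (simp only: sup_conv_SUP)
qed

lemma sigma_morphism_on_inf:
  assumes h: "sigma_morphism_on d e h" and a: "a \<le> d" and b: "b \<le> d"
  shows "h (a \<sqinter> b) = h a \<sqinter> h b"
proof -
  have eq: "x \<sqinter> y = c - ((c - x) \<squnion> (c - y))" if "x \<le> c" "y \<le> c"
    for c x y :: "'c::boolean_algebra"
  proof -
    have "c - ((c - x) \<squnion> (c - y)) = c \<sqinter> (x \<sqinter> y)"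
      by (simp add: diff_eq inf_sup_distrib1 inf.assoc inf.commute inf.left_commute)
    also have "\<dots> = x \<sqinter> y" using that by (intro inf_absorb2 le_infI1)
    finally show ?thesis by simp
  qed
  have *: "d - a \<le> d" "d - b \<le> d" by (auto simp: diff_eq)
  have "h (a \<sqinter> b) = e - (h (d - a) \<squnion> h (d - b))"
    using * by (simp add: eq[OF a b] sigma_morphism_onD(5)[OF h] sigma_morphism_on_sup[OF h])
  also have "\<dots> = h a \<sqinter> h b"
    using a b by (simp add: sigma_morphism_onD[OF h] eq[of "h a" e "h b"])
  finally show ?thesis .
qed


section \<open>The universal abstract sigma-algebra on the open subsets of \<open>[0,\<infinity>]\<close>\<close>

typedef ennreal_opens = "{U :: ennreal set. open U}"
  by (rule exI[of _ "{}"]) simp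

text \<open>
  Formal expressions over the open sets, and the least preorder on them that makes them an
  abstract sigma-algebra (up to equivalence) in which the open sets satisfy the relations of the
  sigma-frame of open sets. The quotient is the algebra with the given generators and relations;
  its universal property is proved at the end of this section.
\<close>

datatype expr =
    Gen ennreal_opens | Bot | Top | Neg expr | Meet expr expr | Join expr expr
  | CJoin "nat \<Rightarrow> expr"

inductive expr_le :: "expr \<Rightarrow> expr \<Rightarrow> bool" where
  e_refl: "expr_le t t"
| e_trans: "expr_le t u \<Longrightarrow> expr_le u v \<Longrightarrow> expr_le t v"
| e_bot: "expr_le Bot t"
| e_top: "expr_le t Top"
| e_meet1: "expr_le (Meet t u) t"
| e_meet2: "expr_le (Meet t u) u"
| e_meet: "expr_le v t \<Longrightarrow> expr_le v u \<Longrightarrow> expr_le v (Meet t u)"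
| e_join1: "expr_le t (Join t u)"
| e_join2: "expr_le u (Join t u)"
| e_join: "expr_le t v \<Longrightarrow> expr_le u v \<Longrightarrow> expr_le (Join t u) v"
| e_distrib: "expr_le (Meet (Join t u) (Join t v)) (Join t (Meet u v))"
| e_neg_meet: "expr_le (Meet t (Neg t)) Bot"
| e_neg_join: "expr_le Top (Join t (Neg t))"
| e_cjoin_upper: "expr_le (T i) (CJoin T)"
| e_cjoin_least: "(\<And>i. expr_le (T i) v) \<Longrightarrow> expr_le (CJoin T) v"
| e_gen_mono: "Rep_ennreal_opens U \<subseteq> Rep_ennreal_opens V \<Longrightarrow> expr_le (Gen U) (Gen V)"
| e_gen_bot: "Rep_ennreal_opens U = {} \<Longrightarrow> expr_le (Gen U) Bot"
| e_gen_top: "Rep_ennreal_opens U = UNIV \<Longrightarrow> expr_le Top (Gen U)"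
| e_gen_meet: "Rep_ennreal_opens W = Rep_ennreal_opens U \<inter> Rep_ennreal_opens V \<Longrightarrow>
    expr_le (Meet (Gen U) (Gen V)) (Gen W)"
| e_gen_cjoin: "Rep_ennreal_opens W = (\<Union>i. Rep_ennreal_opens (F i)) \<Longrightarrow>
    expr_le (Gen W) (CJoin (\<lambda>i. Gen (F i)))"

lemma expr_neg_anti:
  assumes "expr_le t u"
  shows "expr_le (Neg u) (Neg t)"
proof -
  have "expr_le (Neg u) (Meet (Join (Neg t) t) (Join (Neg t) (Neg u)))"
    by (meson expr_le.e_meet expr_le.e_join expr_le.e_join1 expr_le.e_join2 expr_le.e_neg_join
        expr_le.e_top expr_le.e_trans)
  then have "expr_le (Neg u) (Join (Neg t) (Meet t (Neg u)))"
    using expr_le.e_distrib expr_le.e_trans by blast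
  moreover have "expr_le (Meet t (Neg u)) Bot"
    by (meson assms expr_le.e_meet expr_le.e_meet1 expr_le.e_meet2 expr_le.e_neg_meet expr_le.e_trans)
  ultimately show ?thesis
    by (meson expr_le.e_bot expr_le.e_join expr_le.e_refl expr_le.e_trans)
qed

definition expr_eq :: "expr \<Rightarrow> expr \<Rightarrow> bool" where
  "expr_eq t u \<longleftrightarrow> expr_le t u \<and> expr_le u t"

quotient_type borel_alg = expr / expr_eq
proof (rule equivpI)
  show "reflp expr_eq" by (simp add: reflp_def expr_eq_def expr_le.e_refl)
  show "symp expr_eq" by (auto simp: symp_def expr_eq_def)
  show "transp expr_eq" unfolding transp_def expr_eq_def by (meson expr_le.e_trans)
qed

lift_definition cjoin :: "(nat \<Rightarrow> borel_alg) \<Rightarrow> borel_alg" is CJoin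
  unfolding rel_fun_def expr_eq_def
  by (meson expr_le.e_cjoin_least expr_le.e_cjoin_upper expr_le.e_trans)

lift_definition gen :: "ennreal_opens \<Rightarrow> borel_alg" is Gen .

instantiation borel_alg :: abstract_sigma_algebra
begin

lift_definition less_eq_borel_alg :: "borel_alg \<Rightarrow> borel_alg \<Rightarrow> bool" is expr_le
  unfolding expr_eq_def by (meson expr_le.e_trans)

definition less_borel_alg :: "borel_alg \<Rightarrow> borel_alg \<Rightarrow> bool" where
  "less_borel_alg a b \<longleftrightarrow> a \<le> b \<and> \<not> b \<le> a"

lift_definition bot_borel_alg :: borel_alg is Bot .

lift_definition top_borel_alg :: borel_alg is Top .

lift_definition uminus_borel_alg :: "borel_alg \<Rightarrow> borel_alg" is Neg
  unfolding expr_eq_def by (blast intro: expr_neg_anti)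

lift_definition inf_borel_alg :: "borel_alg \<Rightarrow> borel_alg \<Rightarrow> borel_alg" is Meet
  unfolding expr_eq_def
  by (meson expr_le.e_meet expr_le.e_meet1 expr_le.e_meet2 expr_le.e_trans)

lift_definition sup_borel_alg :: "borel_alg \<Rightarrow> borel_alg \<Rightarrow> borel_alg" is Join
  unfolding expr_eq_def
  by (meson expr_le.e_join expr_le.e_join1 expr_le.e_join2 expr_le.e_trans)

definition minus_borel_alg :: "borel_alg \<Rightarrow> borel_alg \<Rightarrow> borel_alg" where
  "minus_borel_alg a b = a \<sqinter> - b"

definition Sup_borel_alg :: "borel_alg set \<Rightarrow> borel_alg" where
  "Sup_borel_alg A = (if A = {} then \<bottom> else cjoin (from_nat_into A))"

definition Inf_borel_alg :: "borel_alg set \<Rightarrow> borel_alg" where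
  "Inf_borel_alg A = - Sup (uminus ` A)"

instance
proof -
  have cjoin_upper: "F i \<le> cjoin F" for F i
    by transfer (rule expr_le.e_cjoin_upper)
  have cjoin_least: "cjoin F \<le> v" if "\<And>i. F i \<le> v" for F v
    using that by transfer (rule expr_le.e_cjoin_least)
  have anti: "- y \<le> - x" if "x \<le> y" for x y :: borel_alg
    using that by transfer (rule expr_neg_anti)
  have ord: "class.order ((\<le>) :: borel_alg \<Rightarrow> _) (<)"
  proof
    fix x y z :: borel_alg
    show "x < y \<longleftrightarrow> x \<le> y \<and> \<not> y \<le> x" by (rule less_borel_alg_def)
    show "x \<le> x" by transfer (rule expr_le.e_refl)
    show "x \<le> y \<Longrightarrow> y \<le> z \<Longrightarrow> x \<le> z" by transfer (rule expr_le.e_trans)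
    show "x \<le> y \<Longrightarrow> y \<le> x \<Longrightarrow> x = y" by transfer (simp add: expr_eq_def)
  qed
  interpret order "(\<le>) :: borel_alg \<Rightarrow> _" "(<)" by (rule ord)
  have ba: "class.boolean_algebra minus uminus (\<sqinter>) (\<le>) (<) (\<squnion>) \<bottom> (\<top> :: borel_alg)"
  proof
    fix x y z :: borel_alg
    show "x \<sqinter> y \<le> x" by transfer (rule expr_le.e_meet1)
    show "x \<sqinter> y \<le> y" by transfer (rule expr_le.e_meet2)
    show "x \<le> y \<Longrightarrow> x \<le> z \<Longrightarrow> x \<le> y \<sqinter> z" by transfer (rule expr_le.e_meet)
    show "x \<le> x \<squnion> y" by transfer (rule expr_le.e_join1)
    show "y \<le> x \<squnion> y" by transfer (rule expr_le.e_join2)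
    show "y \<le> x \<Longrightarrow> z \<le> x \<Longrightarrow> y \<squnion> z \<le> x" by transfer (rule expr_le.e_join)
    show "\<bottom> \<le> x" by transfer (rule expr_le.e_bot)
    show "x \<le> \<top>" by transfer (rule expr_le.e_top)
    show "x \<squnion> (y \<sqinter> z) = (x \<squnion> y) \<sqinter> (x \<squnion> z)"
      by transfer (unfold expr_eq_def, meson expr_le.e_distrib expr_le.e_trans expr_le.e_meet
          expr_le.e_meet1 expr_le.e_meet2 expr_le.e_join expr_le.e_join1 expr_le.e_join2)
    show "x \<sqinter> - x = \<bottom>"
      by transfer (simp add: expr_eq_def expr_le.e_neg_meet expr_le.e_bot)
    show "x \<squnion> - x = \<top>"
      by transfer (simp add: expr_eq_def expr_le.e_neg_join expr_le.e_top)
    show "x - y = x \<sqinter> - y" by (rule minus_borel_alg_def)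
  qed
  interpret ba: boolean_algebra minus uminus "(\<sqinter>)" "(\<le>)" "(<)" "(\<squnion>)" \<bottom> "\<top> :: borel_alg"
    by (rule ba)
  have Sup_upper: "x \<le> Sup A" if "countable A" "x \<in> A" for x and A :: "borel_alg set"
    using that cjoin_upper[of "from_nat_into A" "to_nat_on A x"]
    by (auto simp: Sup_borel_alg_def)
  have Sup_least: "Sup A \<le> z" if "\<And>x. x \<in> A \<Longrightarrow> x \<le> z" for z and A :: "borel_alg set"
    using that by (auto simp: Sup_borel_alg_def intro!: cjoin_least from_nat_into)
  show "OFCLASS(borel_alg, abstract_sigma_algebra_class)"
  proof (intro_classes)
    fix x y z :: borel_alg and A :: "borel_alg set"
    show "x < y \<longleftrightarrow> x \<le> y \<and> \<not> y \<le> x" by (rule less_borel_alg_def)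
    show "x \<le> x" by (rule order_refl)
    show "x \<le> y \<Longrightarrow> y \<le> z \<Longrightarrow> x \<le> z" by (rule order_trans)
    show "x \<le> y \<Longrightarrow> y \<le> x \<Longrightarrow> x = y" by (rule order.antisym)
    show "x \<sqinter> y \<le> x" by (rule ba.inf_le1)
    show "x \<sqinter> y \<le> y" by (rule ba.inf_le2)
    show "x \<le> y \<Longrightarrow> x \<le> z \<Longrightarrow> x \<le> y \<sqinter> z" by (rule ba.inf_greatest)
    show "x \<le> x \<squnion> y" by (rule ba.sup_ge1)
    show "y \<le> x \<squnion> y" by (rule ba.sup_ge2)
    show "y \<le> x \<Longrightarrow> z \<le> x \<Longrightarrow> y \<squnion> z \<le> x" by (rule ba.sup_least)
    show "\<bottom> \<le> x" by (rule ba.bot_least)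
    show "x \<le> \<top>" by (rule ba.top_greatest)
    show "x \<squnion> (y \<sqinter> z) = (x \<squnion> y) \<sqinter> (x \<squnion> z)" by (rule ba.sup_inf_distrib1)
    show "x \<sqinter> - x = \<bottom>" by (rule ba.inf_compl_bot)
    show "x \<squnion> - x = \<top>" by (rule ba.sup_compl_top)
    show "x - y = x \<sqinter> - y" by (rule minus_borel_alg_def)
    show "countable A \<Longrightarrow> x \<in> A \<Longrightarrow> x \<le> Sup A" by (rule Sup_upper)
    show "countable A \<Longrightarrow> (\<And>x. x \<in> A \<Longrightarrow> x \<le> z) \<Longrightarrow> Sup A \<le> z" by (rule Sup_least)
    show "Sup {} = (\<bottom> :: borel_alg)" by (simp add: Sup_borel_alg_def)
    show "Inf {} = (\<top> :: borel_alg)" by (simp add: Inf_borel_alg_def Sup_borel_alg_def)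
    show "Inf A \<le> x" if "countable A" "x \<in> A"
    proof -
      have "- x \<le> Sup (uminus ` A)" using that by (intro Sup_upper) auto
      from anti[OF this] show ?thesis by (simp add: Inf_borel_alg_def)
    qed
    show "z \<le> Inf A" if "countable A" "\<And>x. x \<in> A \<Longrightarrow> z \<le> x"
    proof -
      have "Sup (uminus ` A) \<le> - z" using that anti by (intro Sup_least) auto
      from anti[OF this] show ?thesis by (simp add: Inf_borel_alg_def)
    qed
  qed
qed

end

text \<open>
  An open set regarded as an element of the algebra. The value at a set that is not open is
  meaningless.
\<close>

definition opn :: "ennreal set \<Rightarrow> borel_alg" where
  "opn U = gen (Abs_ennreal_opens U)"

text \<open>The sigma-frame morphisms from the open subsets of \<open>[0,\<infinity>]\<close> to an abstract sigma-algebra.\<close>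

definition sigma_frame_morphism :: "(ennreal set \<Rightarrow> 'a::abstract_sigma_algebra) \<Rightarrow> bool" where
  "sigma_frame_morphism \<phi> \<longleftrightarrow>
     \<phi> {} = \<bottom> \<and> \<phi> UNIV = \<top> \<and>
     (\<forall>U V. open U \<longrightarrow> open V \<longrightarrow> \<phi> (U \<inter> V) = \<phi> U \<sqinter> \<phi> V) \<and>
     (\<forall>U :: nat \<Rightarrow> ennreal set. (\<forall>i. open (U i)) \<longrightarrow> \<phi> (\<Union>i. U i) = (SUP i. \<phi> (U i)))"

lemma cjoin_eq_SUP: "cjoin F = (SUP i. F i)"
proof (rule antisym)
  have *: "F i \<le> (SUP i. F i)" for i by (rule ccSUP_upper) auto
  have least: "cjoin F \<le> v" if "\<And>i. F i \<le> v" for v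
    using that by transfer (rule expr_le.e_cjoin_least)
  show "cjoin F \<le> (SUP i. F i)" by (rule least) (rule *)
  have upper: "F i \<le> cjoin F" for i
    by transfer (rule expr_le.e_cjoin_upper)
  show "(SUP i. F i) \<le> cjoin F" by (rule ccSUP_least) (auto intro: upper)
qed

lemma expr_cjoin_mono: "(\<And>i. expr_le (T i) (U i)) \<Longrightarrow> expr_le (CJoin T) (CJoin U)"
  by (meson expr_le.e_cjoin_least expr_le.e_cjoin_upper expr_le.e_trans)

lemma rep_abs_le:
  "expr_le (rep_borel_alg (abs_borel_alg t)) t" "expr_le t (rep_borel_alg (abs_borel_alg t))"
proof -
  have "expr_eq (rep_borel_alg (abs_borel_alg t)) t"
    by (rule Quotient3_rep_abs[OF Quotient3_borel_alg]) (simp add: expr_eq_def expr_le.e_refl)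
  then show "expr_le (rep_borel_alg (abs_borel_alg t)) t"
    "expr_le t (rep_borel_alg (abs_borel_alg t))" by (auto simp: expr_eq_def)
qed

lemma abs_CJoin: "abs_borel_alg (CJoin T) = (SUP i. abs_borel_alg (T i))"
proof -
  have "cjoin (\<lambda>i. abs_borel_alg (T i)) = abs_borel_alg (CJoin T)"
    unfolding cjoin_def
    by (auto simp: borel_alg.abs_eq_iff expr_eq_def map_fun_def intro!: expr_cjoin_mono rep_abs_le)
  then show ?thesis by (simp add: cjoin_eq_SUP)
qed

lemma opn_mono:
  assumes "open U" "open V" "U \<subseteq> V"
  shows "opn U \<le> opn V"
  unfolding opn_def using assms
  by (transfer fixing: U V) (auto intro!: expr_le.e_gen_mono simp: Abs_ennreal_opens_inverse)

lemma sigma_frame_morphism_opn: "sigma_frame_morphism opn"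
  unfolding sigma_frame_morphism_def
proof (intro conjI allI impI)
  show "opn {} = \<bottom>"
    unfolding opn_def
    by transfer (simp add: expr_eq_def expr_le.e_bot expr_le.e_gen_bot Abs_ennreal_opens_inverse)
  show "opn UNIV = \<top>"
    unfolding opn_def
    by transfer (simp add: expr_eq_def expr_le.e_top expr_le.e_gen_top Abs_ennreal_opens_inverse)
next
  fix U V :: "ennreal set"
  assume o: "open U" "open V"
  have "opn U \<sqinter> opn V \<le> opn (U \<inter> V)"
    unfolding opn_def using o
    by (transfer fixing: U V) (rule expr_le.e_gen_meet, simp add: Abs_ennreal_opens_inverse open_Int)
  then show "opn (U \<inter> V) = opn U \<sqinter> opn V"
    using o by (intro antisym le_infI opn_mono) auto
next
  fix U :: "nat \<Rightarrow> ennreal set"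
  assume o: "\<forall>i. open (U i)"
  have "opn (\<Union>i. U i) \<le> cjoin (\<lambda>i. opn (U i))"
    unfolding opn_def using o
    by (transfer fixing: U) (rule expr_le.e_gen_cjoin, simp add: Abs_ennreal_opens_inverse open_UN)
  then show "opn (\<Union>i. U i) = (SUP i. opn (U i))"
    using o by (intro antisym) (auto simp: cjoin_eq_SUP intro!: ccSUP_least opn_mono)
qed

primrec expr_interp :: "(ennreal set \<Rightarrow> 'a::abstract_sigma_algebra) \<Rightarrow> expr \<Rightarrow> 'a" where
  "expr_interp \<phi> (Gen U) = \<phi> (Rep_ennreal_opens U)"
| "expr_interp \<phi> Bot = \<bottom>"
| "expr_interp \<phi> Top = \<top>"
| "expr_interp \<phi> (Neg t) = - expr_interp \<phi> t"
| "expr_interp \<phi> (Meet t u) = expr_interp \<phi> t \<sqinter> expr_interp \<phi> u"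
| "expr_interp \<phi> (Join t u) = expr_interp \<phi> t \<squnion> expr_interp \<phi> u"
| "expr_interp \<phi> (CJoin T) = (SUP i. expr_interp \<phi> (T i))"

lemma expr_interp_mono:
  assumes \<phi>: "sigma_frame_morphism \<phi>" and "expr_le t u"
  shows "expr_interp \<phi> t \<le> expr_interp \<phi> u"
  using assms(2)
proof induction
  case (e_gen_mono U V)
  have o: "open (Rep_ennreal_opens W)" for W using Rep_ennreal_opens by auto
  from e_gen_mono have "Rep_ennreal_opens U = Rep_ennreal_opens U \<inter> Rep_ennreal_opens V" by blast
  then have "\<phi> (Rep_ennreal_opens U) = \<phi> (Rep_ennreal_opens U) \<sqinter> \<phi> (Rep_ennreal_opens V)"
    using \<phi> o unfolding sigma_frame_morphism_def by metis
  then show ?case by (simp add: inf.order_iff)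
next
  case (e_gen_meet W U V)
  then show ?case
    using \<phi> Rep_ennreal_opens unfolding sigma_frame_morphism_def by auto
next
  case (e_gen_cjoin W F)
  then show ?case
    using \<phi> Rep_ennreal_opens unfolding sigma_frame_morphism_def by auto
next
  case (e_cjoin_upper T i)
  then show ?case by (auto intro: ccSUP_upper)
next
  case (e_cjoin_least T v)
  then show ?case by (auto intro!: ccSUP_least)
next
  case (e_trans t u v)
  show ?case using e_trans.IH by (rule order_trans)
qed (use \<phi> in \<open>auto simp: sigma_frame_morphism_def sup_inf_distrib1\<close>)

theorem borel_alg_universal:
  fixes \<phi> :: "ennreal set \<Rightarrow> 'a::abstract_sigma_algebra"
  assumes \<phi>: "sigma_frame_morphism \<phi>"
  shows "\<exists>!f. sigma_morphism f \<and> (\<forall>U. open U \<longrightarrow> f (opn U) = \<phi> U)"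
proof (rule ex_ex1I)
  define f where "f b = expr_interp \<phi> (rep_borel_alg b)" for b
  have resp: "expr_interp \<phi> t = expr_interp \<phi> u" if "expr_eq t u" for t u
    using that expr_interp_mono[OF \<phi>] by (auto simp: expr_eq_def intro: antisym)
  have f_abs: "f (abs_borel_alg t) = expr_interp \<phi> t" for t
    unfolding f_def
    by (intro resp Quotient3_rep_abs[OF Quotient3_borel_alg]) (simp add: expr_eq_def expr_le.e_refl)
  have mono: "f a \<le> f b" if "a \<le> b" for a b
    unfolding f_def using that by (intro expr_interp_mono[OF \<phi>]) (simp add: less_eq_borel_alg.rep_eq)
  have neg: "f (- a) = - f a" for a
    by (induct a rule: borel_alg.abs_induct) (simp add: f_abs uminus_borel_alg.abs_eq)
  have cj: "f (SUP i. F i) = (SUP i. f (F i))" for F :: "nat \<Rightarrow> borel_alg"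
  proof -
    define T where "T i = rep_borel_alg (F i)" for i
    have F: "F = (\<lambda>i. abs_borel_alg (T i))"
      unfolding T_def using Quotient3_abs_rep[OF Quotient3_borel_alg] by simp
    show ?thesis by (simp add: F f_abs flip: abs_CJoin)
  qed
  have "sigma_morphism f"
    unfolding sigma_morphism_def sigma_morphism_on_def
    using mono neg cj f_abs[of Bot] f_abs[of Top]
    by (auto simp: diff_eq bot_borel_alg_def[symmetric] top_borel_alg_def[symmetric])
  moreover have "f (opn U) = \<phi> U" if "open U" for U
    using that by (simp add: opn_def gen.abs_eq f_abs Abs_ennreal_opens_inverse)
  ultimately show "\<exists>f. sigma_morphism f \<and> (\<forall>U. open U \<longrightarrow> f (opn U) = \<phi> U)" by blast
next
  fix f g :: "borel_alg \<Rightarrow> 'a"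
  assume f: "sigma_morphism f \<and> (\<forall>U. open U \<longrightarrow> f (opn U) = \<phi> U)"
    and g: "sigma_morphism g \<and> (\<forall>U. open U \<longrightarrow> g (opn U) = \<phi> U)"
  note F = conjunct1[OF f, unfolded sigma_morphism_def]
  note G = conjunct1[OF g, unfolded sigma_morphism_def]
  have "f (abs_borel_alg t) = g (abs_borel_alg t)" for t
  proof (induction t)
    case (Gen U)
    have "abs_borel_alg (Gen U) = opn (Rep_ennreal_opens U)"
      by (simp add: opn_def gen.abs_eq Rep_ennreal_opens_inverse)
    then show ?case using f g Rep_ennreal_opens[of U] by simp
  next
    case Bot
    then show ?case
      using sigma_morphism_onD(3)[OF F] sigma_morphism_onD(3)[OF G] by (simp add: bot_borel_alg_def)
  next
    case Top
    then show ?case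
      using sigma_morphism_onD(4)[OF F] sigma_morphism_onD(4)[OF G] by (simp add: top_borel_alg_def)
  next
    case (Neg t)
    then show ?case
      using sigma_morphism_onD(5)[OF F, of "abs_borel_alg t"]
        sigma_morphism_onD(5)[OF G, of "abs_borel_alg t"]
      by (simp add: diff_eq uminus_borel_alg.abs_eq)
  next
    case (Meet t u)
    then show ?case
      using sigma_morphism_on_inf[OF F, of "abs_borel_alg t" "abs_borel_alg u"]
        sigma_morphism_on_inf[OF G, of "abs_borel_alg t" "abs_borel_alg u"]
      by (simp add: inf_borel_alg.abs_eq)
  next
    case (Join t u)
    then show ?case
      using sigma_morphism_on_sup[OF F, of "abs_borel_alg t" "abs_borel_alg u"]
        sigma_morphism_on_sup[OF G, of "abs_borel_alg t" "abs_borel_alg u"]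
      by (simp add: sup_borel_alg.abs_eq)
  next
    case (CJoin T)
    show ?case
      using sigma_morphism_onD(6)[OF F, of "\<lambda>i. abs_borel_alg (T i)"]
        sigma_morphism_onD(6)[OF G, of "\<lambda>i. abs_borel_alg (T i)"] CJoin
      by (simp add: abs_CJoin)
  qed
  then have "f b = g b" for b
    by (induct b rule: borel_alg.abs_induct)
  then show "f = g" by (rule ext)
qed

hide_const (open) Gen Bot Top Neg Meet Join CJoin gen cjoin


section \<open>Non-negative measurable functions and their integral\<close>

definition nonneg_measurable :: "(borel_alg \<Rightarrow> 'a::abstract_sigma_algebra) \<Rightarrow> bool" where
  "nonneg_measurable f \<longleftrightarrow> sigma_morphism f"

text \<open>The element \<open>[0,t]\<close>, the complement of the open set \<open>(t,\<infinity>]\<close>.\<close>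

definition cl_upto :: "ennreal \<Rightarrow> borel_alg" where
  "cl_upto t = - opn {t<..}"

definition meas_le ::
    "(borel_alg \<Rightarrow> 'a::abstract_sigma_algebra) \<Rightarrow> (borel_alg \<Rightarrow> 'a) \<Rightarrow> bool" where
  "meas_le f g \<longleftrightarrow> (\<forall>t. f (cl_upto t) \<ge> g (cl_upto t))"

definition increases_to ::
    "(nat \<Rightarrow> borel_alg \<Rightarrow> 'a::abstract_sigma_algebra) \<Rightarrow> (borel_alg \<Rightarrow> 'a) \<Rightarrow> bool" where
  "increases_to F f \<longleftrightarrow>
     (\<forall>n. meas_le (F n) (F (Suc n))) \<and> (\<forall>n. meas_le (F n) f) \<and>
     (\<forall>t. f (cl_upto t) = (INF n. F n (cl_upto t)))"

text \<open>The factorizations \<open>f = s \<circ> \<kappa>\<close> of \<open>f\<close> through the power set of \<open>{0,\<dots>,n}\<close>.\<close>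

definition simple_factorization ::
    "(borel_alg \<Rightarrow> 'a::abstract_sigma_algebra) \<Rightarrow> nat \<Rightarrow> (borel_alg \<Rightarrow> nat set) \<Rightarrow>
     (nat set \<Rightarrow> 'a) \<Rightarrow> bool" where
  "simple_factorization f n \<kappa> s \<longleftrightarrow>
     sigma_morphism_on \<top> {..n} \<kappa> \<and> sigma_morphism_on {..n} \<top> s \<and> f = s \<circ> \<kappa>"

definition simple_fn :: "(borel_alg \<Rightarrow> 'a::abstract_sigma_algebra) \<Rightarrow> bool" where
  "simple_fn f \<longleftrightarrow> nonneg_measurable f \<and> (\<exists>n \<kappa> s. simple_factorization f n \<kappa> s)"

definition induced_by_points :: "nat \<Rightarrow> (borel_alg \<Rightarrow> nat set) \<Rightarrow> (nat \<Rightarrow> ennreal) \<Rightarrow> bool" where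
  "induced_by_points n \<kappa> x \<longleftrightarrow> (\<forall>U. open U \<longrightarrow> \<kappa> (opn U) = {i \<in> {..n}. x i \<in> U})"

text \<open>
  The integral of a simple function is computed from any of its factorizations; that one exists
  and that the value does not depend on it is \<open>simple_lint_well_defined\<close> below.
\<close>

definition simple_lint ::
    "('a::abstract_sigma_algebra \<Rightarrow> ennreal) \<Rightarrow> (borel_alg \<Rightarrow> 'a) \<Rightarrow> ennreal" where
  "simple_lint \<mu> f = (THE v. \<exists>n \<kappa> s x. simple_factorization f n \<kappa> s \<and>
     induced_by_points n \<kappa> x \<and> v = (\<Sum>i\<le>n. \<mu> (s {i}) * x i))"

definition lint ::
    "('a::abstract_sigma_algebra \<Rightarrow> ennreal) \<Rightarrow> (borel_alg \<Rightarrow> 'a) \<Rightarrow> ennreal" where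
  "lint \<mu> f = Sup {simple_lint \<mu> g |g. simple_fn g \<and> meas_le g f}"


section \<open>Well-definedness of the integral of a simple function\<close>

lemma factorization_induced_by_points:
  assumes "simple_factorization f n \<kappa> s"
  shows "\<exists>x. induced_by_points n \<kappa> x"
proof -
  note K = assms[unfolded simple_factorization_def, THEN conjunct1]
  have K_mono: "\<kappa> (opn U) \<subseteq> \<kappa> (opn V)" if "open U" "open V" "U \<subseteq> V" for U V
    by (rule sigma_morphism_onD(2)[OF K]) (use opn_mono that in auto)
  note O = sigma_frame_morphism_opn[unfolded sigma_frame_morphism_def]
  have K_empty: "\<kappa> (opn {}) = {}" and K_UNIV: "\<kappa> (opn UNIV) = {..n}"
    using O sigma_morphism_onD(3,4)[OF K] by simp_all
  have K_Int: "\<kappa> (opn (U \<inter> V)) = \<kappa> (opn U) \<inter> \<kappa> (opn V)" if "open U" "open V" for U V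
    using O sigma_morphism_on_inf[OF K, of "opn U" "opn V"] that by simp
  have K_UN: "\<kappa> (opn (\<Union>i. G i)) = (\<Union>i. \<kappa> (opn (G i)))"
    if "\<And>i. open (G i)" for G :: "nat \<Rightarrow> ennreal set"
  proof -
    have "opn (\<Union>i. G i) = (SUP i. opn (G i))" using O that by blast
    then show ?thesis using sigma_morphism_onD(6)[OF K, of "\<lambda>i. opn (G i)"] by simp
  qed
  have "\<exists>p. \<forall>U. open U \<longrightarrow> (i \<in> \<kappa> (opn U) \<longleftrightarrow> p \<in> U)" if "i \<le> n" for i
  proof -
    define D where "D = {U :: ennreal set. open U \<and> i \<notin> \<kappa> (opn U)}"
    have D_open: "\<And>S. S \<in> D \<Longrightarrow> open S" by (simp add: D_def)
    obtain D' where D': "D' \<subseteq> D" "countable D'" "\<Union>D' = \<Union>D"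
      using Lindelof[of D, OF D_open] by metis
    define G where "G = from_nat_into (insert {} D')"
    have "{} \<in> D" by (simp add: D_def K_empty)
    then have range_G: "range G = insert {} D'" "insert {} D' \<subseteq> D"
      using D' by (simp_all add: G_def range_from_nat_into)
    then have "G k \<in> D" for k by (metis rangeI subsetD)
    then have G: "open (G k)" "i \<notin> \<kappa> (opn (G k))" for k
      by (simp_all add: D_def)
    have "(\<Union>k. G k) = \<Union>D" using range_G D' by auto
    with K_UN[of G] G have W: "i \<notin> \<kappa> (opn (\<Union>D))" by simp
    have oW: "open (\<Union>D)" by (auto simp: D_def)
    have "\<Union>D \<noteq> UNIV" using W K_UNIV that by auto
    then obtain p where p: "p \<notin> \<Union>D" by blast
    have "i \<in> \<kappa> (opn U) \<longleftrightarrow> p \<in> U" if U: "open U" for U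
    proof
      assume "p \<in> U"
      then show "i \<in> \<kappa> (opn U)" using p U by (auto simp: D_def)
    next
      assume i: "i \<in> \<kappa> (opn U)"
      show "p \<in> U"
      proof (rule ccontr)
        assume "p \<notin> U"
        have "q \<in> \<Union>D" if "q \<noteq> p" for q
        proof -
          obtain A B where AB: "open A" "open B" "q \<in> A" "p \<in> B" "A \<inter> B = {}"
            using hausdorff[OF \<open>q \<noteq> p\<close>] by blast
          have "i \<in> \<kappa> (opn B)" using p AB by (auto simp: D_def)
          with K_Int[of A B] AB K_empty have "i \<notin> \<kappa> (opn A)" by auto
          with AB show ?thesis by (auto simp: D_def)
        qed
        then have "U \<subseteq> \<Union>D" using \<open>p \<notin> U\<close> by (metis subsetI)
        from K_mono[OF U oW this] i W show False by blast
      qed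
    qed
    then show ?thesis by blast
  qed
  then have "\<forall>i. \<exists>p. i \<le> n \<longrightarrow> (\<forall>U. open U \<longrightarrow> (i \<in> \<kappa> (opn U) \<longleftrightarrow> p \<in> U))"
    by blast
  from choice[OF this] obtain x
    where x: "\<And>i U. i \<le> n \<Longrightarrow> open U \<Longrightarrow> i \<in> \<kappa> (opn U) \<longleftrightarrow> x i \<in> U"
    by blast
  have "\<kappa> (opn U) = {i \<in> {..n}. x i \<in> U}" if "open U" for U
    using sigma_morphism_onD(1)[OF K, of "opn U"] x[OF _ that] by auto
  then have "induced_by_points n \<kappa> x"
    unfolding induced_by_points_def by simp
  then show ?thesis by blast
qed

lemma inf_SUP_nat:
  fixes a :: "'a::abstract_sigma_algebra" and A :: "nat \<Rightarrow> 'a"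
  shows "a \<sqinter> (SUP i. A i) = (SUP i. a \<sqinter> A i)"
proof (rule antisym)
  have "A i \<le> - a \<squnion> (SUP i. a \<sqinter> A i)" for i
  proof -
    have "a \<sqinter> A i \<le> (SUP i. a \<sqinter> A i)" by (rule ccSUP_upper) auto
    then show ?thesis by (simp add: shunt1 inf.commute[of a])
  qed
  then have "(SUP i. A i) \<le> - a \<squnion> (SUP i. a \<sqinter> A i)"
    by (intro ccSUP_least) auto
  then show "a \<sqinter> (SUP i. A i) \<le> (SUP i. a \<sqinter> A i)"
    by (simp add: shunt1 inf.commute[of a])
  show "(SUP i. a \<sqinter> A i) \<le> a \<sqinter> (SUP i. A i)"
    by (intro ccSUP_least le_infI inf_le1 le_infI2 ccSUP_upper) auto
qed

lemma sigma_measureD: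
  fixes \<mu> :: "'a::abstract_sigma_algebra \<Rightarrow> ennreal" and A :: "nat \<Rightarrow> 'a"
  assumes "sigma_measure \<mu>"
  shows "\<mu> \<bottom> = 0"
    and "(\<And>i j. i \<noteq> j \<Longrightarrow> A i \<sqinter> A j = \<bottom>) \<Longrightarrow> \<mu> (SUP i. A i) = (\<Sum>i. \<mu> (A i))"
  using assms unfolding sigma_measure_def by simp_all

lemma measure_partition:
  fixes s :: "nat set \<Rightarrow> 'a::abstract_sigma_algebra"
  assumes \<mu>: "sigma_measure \<mu>" and s: "sigma_morphism_on {..n} \<top> s"
  shows "\<mu> a = (\<Sum>i\<le>n. \<mu> (a \<sqinter> s {i}))"
proof -
  define P where "P i = (if i \<le> n then {i} else {})" for i :: nat
  have P: "P i \<le> {..n}" for i by (auto simp: P_def)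
  have "(SUP i. P i) = {..n}" by (auto simp: P_def split: if_splits)
  then have top: "(SUP i. s (P i)) = \<top>"
    using sigma_morphism_onD(6)[OF s, of P] sigma_morphism_onD(4)[OF s] P by simp
  have disj: "(a \<sqinter> s (P i)) \<sqinter> (a \<sqinter> s (P j)) = \<bottom>" if "i \<noteq> j" for i j
  proof -
    have "s (P i) \<sqinter> s (P j) = s (P i \<inter> P j)" by (simp add: sigma_morphism_on_inf[OF s P P])
    also have "P i \<inter> P j = \<bottom>" using that by (auto simp: P_def)
    finally have "s (P i) \<sqinter> s (P j) = \<bottom>" by (simp add: sigma_morphism_onD(3)[OF s])
    then show ?thesis by (simp add: inf.left_commute inf.assoc)
  qed
  have "(SUP i. a \<sqinter> s (P i)) = a"
    by (simp only: inf_SUP_nat[symmetric] top inf_top_right)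
  then have "\<mu> a = \<mu> (SUP i. a \<sqinter> s (P i))" by (rule arg_cong[OF sym])
  also have "\<dots> = (\<Sum>i. \<mu> (a \<sqinter> s (P i)))"
    by (rule sigma_measureD(2)[OF \<mu>]) (rule disj)
  also have "\<dots> = (\<Sum>i\<le>n. \<mu> (a \<sqinter> s (P i)))"
    by (rule suminf_finite)
       (use sigma_measureD(1)[OF \<mu>] sigma_morphism_onD(3)[OF s] in \<open>simp_all add: P_def\<close>)
  finally show ?thesis by (simp add: P_def)
qed

theorem simple_lint_well_defined:
  assumes \<mu>: "sigma_measure \<mu>" and f: "simple_fn f"
  shows "\<exists>!v. \<exists>n \<kappa> s x. simple_factorization f n \<kappa> s \<and>
           induced_by_points n \<kappa> x \<and> v = (\<Sum>i\<le>n. \<mu> (s {i}) * x i)"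
proof (rule ex_ex1I)
  from f obtain n \<kappa> s where A: "simple_factorization f n \<kappa> s"
    unfolding simple_fn_def by blast
  then obtain x where "induced_by_points n \<kappa> x"
    using factorization_induced_by_points by blast
  with A show "\<exists>v n \<kappa> s x. simple_factorization f n \<kappa> s \<and> induced_by_points n \<kappa> x \<and>
          v = (\<Sum>i\<le>n. \<mu> (s {i}) * x i)"
    by (intro exI conjI) (assumption, assumption, rule refl)
next
  have *: "(\<Sum>i\<le>n. \<mu> (s {i}) * x i) = (\<Sum>j\<le>m. \<mu> (s' {j}) * y j)"
    if A: "simple_factorization f n \<kappa> s" "induced_by_points n \<kappa> x"
      and B: "simple_factorization f m \<kappa>' s'" "induced_by_points m \<kappa>' y"
    for n m \<kappa> \<kappa>' s s' x y
  proof -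
    have s: "sigma_morphism_on {..n} \<top> s" and s': "sigma_morphism_on {..m} \<top> s'"
      and F: "f = s \<circ> \<kappa>" "f = s' \<circ> \<kappa>'"
      using A B by (auto simp: simple_factorization_def)
    have f_morph: "sigma_morphism_on \<top> \<top> f"
      using f by (simp add: simple_fn_def nonneg_measurable_def sigma_morphism_def)
    have eq: "\<mu> (s {i} \<sqinter> s' {j}) * x i = \<mu> (s {i} \<sqinter> s' {j}) * y j" if "i \<le> n" "j \<le> m" for i j
    proof (cases "x i = y j")
      case False
      obtain U V where UV: "open U" "open V" "x i \<in> U" "y j \<in> V" "U \<inter> V = {}"
        using hausdorff[OF False] by blast
      have "s {i} \<le> s (\<kappa> (opn U))"
        using UV that A by (intro sigma_morphism_onD(2)[OF s]) (auto simp: induced_by_points_def)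
      moreover have "s' {j} \<le> s' (\<kappa>' (opn V))"
        using UV that B by (intro sigma_morphism_onD(2)[OF s']) (auto simp: induced_by_points_def)
      ultimately have "s {i} \<sqinter> s' {j} \<le> f (opn U) \<sqinter> f (opn V)"
        using F by (metis comp_apply inf_mono)
      also have "\<dots> = f (opn (U \<inter> V))"
        using UV(1,2) sigma_frame_morphism_opn sigma_morphism_on_inf[OF f_morph, of "opn U" "opn V"]
        by (simp add: sigma_frame_morphism_def)
      also have "\<dots> = \<bottom>"
        using sigma_frame_morphism_opn sigma_morphism_onD(3)[OF f_morph] UV(5)
        by (simp add: sigma_frame_morphism_def)
      finally have "s {i} \<sqinter> s' {j} = \<bottom>" by (simp add: bot_unique)
      then show ?thesis by (simp add: sigma_measureD(1)[OF \<mu>])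
    qed simp
    have "(\<Sum>i\<le>n. \<mu> (s {i}) * x i) = (\<Sum>i\<le>n. \<Sum>j\<le>m. \<mu> (s {i} \<sqinter> s' {j}) * x i)"
      by (rule sum.cong, simp, subst measure_partition[OF \<mu> s'], simp add: sum_distrib_right)
    also have "\<dots> = (\<Sum>i\<le>n. \<Sum>j\<le>m. \<mu> (s {i} \<sqinter> s' {j}) * y j)"
      by (auto intro!: sum.cong simp: eq)
    also have "\<dots> = (\<Sum>j\<le>m. \<Sum>i\<le>n. \<mu> (s' {j} \<sqinter> s {i}) * y j)"
      by (subst sum.swap) (simp add: inf.commute)
    also have "\<dots> = (\<Sum>j\<le>m. \<mu> (s' {j}) * y j)"
      by (rule sum.cong, simp, subst (2) measure_partition[OF \<mu> s], simp add: sum_distrib_right)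
    finally show ?thesis .
  qed
  fix v w
  assume "\<exists>n \<kappa> s x. simple_factorization f n \<kappa> s \<and> induced_by_points n \<kappa> x \<and>
            v = (\<Sum>i\<le>n. \<mu> (s {i}) * x i)"
    and "\<exists>n \<kappa> s x. simple_factorization f n \<kappa> s \<and> induced_by_points n \<kappa> x \<and>
            w = (\<Sum>i\<le>n. \<mu> (s {i}) * x i)"
  then show "v = w" by (elim exE conjE) (simp, rule *)
qed

lemma simple_lint_eq:
  assumes "sigma_measure \<mu>" "simple_fn f"
    and "simple_factorization f n \<kappa> s" "induced_by_points n \<kappa> x"
  shows "simple_lint \<mu> f = (\<Sum>i\<le>n. \<mu> (s {i}) * x i)"
  unfolding simple_lint_def
  by (rule the1_equality[OF simple_lint_well_defined[OF assms(1,2)]])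
     (intro exI conjI, rule assms(3), rule assms(4), rule refl)

end

theory Submission
  imports Defs
begin

text \<open>
  The sequence of integrals increases and stays below \<open>lint \<mu> f\<close>, because \<^const>\<open>lint\<close> is monotone.
  So everything rests on showing that each simple \<open>g \<le> f\<close> satisfies
  \<open>simple_lint \<mu> g \<le> (SUP k. lint \<mu> (F k))\<close>.

  There are no points in an abstract sigma-algebra, but the classical argument only speaks about the
  sets where a function exceeds a level, and those are the elements \<open>f (opn {t<..})\<close>. Let \<open>g\<close> take
  the values \<open>x i\<close> on the finite partition \<open>a i\<close>. Where \<open>x i > 0\<close>, lower the value to some
  \<open>y i < x i\<close>; where \<open>x i = 0\<close>, put \<open>y i = 0\<close>, so that \<open>i\<close> contributes nothing to any sum below. In
  the first case \<open>a i \<le> f (opn {y i<..})\<close>, and this element is the join of the increasing sequence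
  \<open>F k (opn {y i<..})\<close>. Hence the pieces \<open>a i \<sqinter> F k (opn {y i<..})\<close> increase to \<open>a i\<close>, and their
  measures increase to \<open>\<mu> (a i)\<close> (\<open>measure_SUP_incseq\<close>). The simple function with value \<open>y i\<close> on the
  \<open>k\<close>-th piece of \<open>a i\<close> and \<open>0\<close> elsewhere lies below \<open>F k\<close> (\<open>sum_le_lint\<close>); letting first \<open>k\<close> grow
  and then \<open>y i\<close> approach \<open>x i\<close> gives the claim.

  Strictly lowering the values takes the place of the usual factor \<open>1 - \<epsilon>\<close>. It works for the value
  \<open>\<infinity>\<close> too, and it is what makes the relation \<open>g \<le> f\<close>, which only speaks of strict superlevel sets,
  applicable.
\<close>

section \<open>Continuity from below of measures\<close>

lemma measure_sup_disjoint:
  assumes \<mu>: "sigma_measure \<mu>" and "a \<sqinter> b = \<bottom>"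
  shows "\<mu> (a \<squnion> b) = \<mu> a + \<mu> b"
proof -
  define A where "A i = (if i = 0 then a else if i = 1 then b else \<bottom>)" for i :: nat
  have "(SUP i. A i) = a \<squnion> b"
  proof (rule antisym)
    have "A 0 \<le> (SUP i. A i)" "A 1 \<le> (SUP i. A i)" by (rule ccSUP_upper; simp)+
    then show "a \<squnion> b \<le> (SUP i. A i)" by (simp add: A_def)
  qed (auto simp: A_def intro!: ccSUP_least)
  moreover have "A i \<sqinter> A j = \<bottom>" if "i \<noteq> j" for i j
    using that assms(2) by (auto simp: A_def inf.commute)
  then have "\<mu> (SUP i. A i) = (\<Sum>i. \<mu> (A i))"
    by (rule sigma_measureD(2)[OF \<mu>])
  moreover have "(\<Sum>i. \<mu> (A i)) = (\<Sum>i\<in>{0, 1}. \<mu> (A i))"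
    by (rule suminf_finite) (simp_all add: A_def sigma_measureD(1)[OF \<mu>])
  ultimately show ?thesis by (simp add: A_def)
qed

lemma measure_mono:
  assumes \<mu>: "sigma_measure \<mu>" and "a \<le> b"
  shows "\<mu> a \<le> \<mu> b"
proof -
  have eq: "b = a \<squnion> (b - a)"
    using \<open>a \<le> b\<close> by (simp add: diff_eq sup_inf_distrib1 sup_absorb2)
  have "\<mu> b = \<mu> a + \<mu> (b - a)"
    by (subst eq, rule measure_sup_disjoint[OF \<mu>]) (simp add: diff_eq inf.left_commute)
  then show ?thesis by simp
qed

text \<open>
  As for measures on sets, \<open>\<Squnion>i. A i\<close> is the join of the pairwise disjoint increments
  \<open>A (Suc i) - A i\<close> (with \<open>A 0\<close> as the first one), and the partial sums of their measures telescope.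
\<close>

lemma measure_SUP_incseq:
  fixes \<mu> :: "'a::abstract_sigma_algebra \<Rightarrow> ennreal"
  assumes \<mu>: "sigma_measure \<mu>" and A: "incseq A"
  shows "\<mu> (SUP i. A i) = (SUP i. \<mu> (A i))"
proof -
  define D where "D i = (case i of 0 \<Rightarrow> A 0 | Suc j \<Rightarrow> A (Suc j) - A j)" for i
  have D_le: "D i \<le> A i" for i
    by (cases i) (auto simp: D_def diff_eq)
  have A_Suc: "A (Suc i) = A i \<squnion> D (Suc i)" for i
    using incseq_SucD[OF A, of i]
    by (simp add: D_def diff_eq sup_inf_distrib1 sup_absorb2)
  have D_disj: "D i \<sqinter> D j = \<bottom>" if "i < j" for i j
  proof -
    from that obtain k where j: "j = Suc k" and "i \<le> k" by (cases j) auto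
    then have "D i \<le> A k" using D_le incseqD[OF A] order_trans by blast
    then have "D i \<sqinter> - A k = \<bottom>"
      using inf_shunt[of "D i" "- A k"] by simp
    then show ?thesis by (simp add: j D_def diff_eq inf.left_commute)
  qed
  have partial_sum: "(\<Sum>j\<le>i. \<mu> (D j)) = \<mu> (A i)" for i
  proof (induction i)
    case 0
    then show ?case by (simp add: D_def)
  next
    case (Suc i)
    have "A i \<sqinter> D (Suc i) = \<bottom>"
      by (simp add: D_def diff_eq inf.left_commute)
    with Suc show ?case
      by (simp add: A_Suc measure_sup_disjoint[OF \<mu>])
  qed
  have "A i \<le> (SUP i. D i)" for i
  proof (induction i)
    case 0
    have "D 0 \<le> (SUP i. D i)" by (rule ccSUP_upper) auto
    then show ?case by (simp add: D_def)
  next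
    case (Suc i)
    have "D (Suc i) \<le> (SUP i. D i)" by (rule ccSUP_upper) auto
    with Suc show ?case by (simp add: A_Suc)
  qed
  then have "(SUP i. A i) = (SUP i. D i)"
    by (intro antisym ccSUP_least ccSUP_mono) (auto intro: D_le)
  also have "\<mu> \<dots> = (\<Sum>i. \<mu> (D i))"
  proof (rule sigma_measureD(2)[OF \<mu>])
    show "D i \<sqinter> D j = \<bottom>" if "i \<noteq> j" for i j
      using D_disj[of i j] D_disj[of j i] that by (auto simp: inf.commute neq_iff)
  qed
  also have "\<dots> = (SUP i. \<Sum>j<i. \<mu> (D j))"
    by (rule suminf_eq_SUP)
  also have "\<dots> = (SUP i. \<Sum>j\<le>i. \<mu> (D j))"
  proof (rule antisym)
    show "(SUP i. \<Sum>j<i. \<mu> (D j)) \<le> (SUP i. \<Sum>j\<le>i. \<mu> (D j))"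
      by (intro SUP_mono' sum_mono2) auto
    show "(SUP i. \<Sum>j\<le>i. \<mu> (D j)) \<le> (SUP i. \<Sum>j<i. \<mu> (D j))"
      by (intro SUP_mono) (metis UNIV_I lessThan_Suc_atMost order_refl)
  qed
  also have "\<dots> = (SUP i. \<mu> (A i))"
    by (simp only: partial_sum)
  finally show ?thesis .
qed

section \<open>Simple functions from partitions and values\<close>

lemma sigma_morphism_on_comp:
  assumes h: "sigma_morphism_on d e h" and k: "sigma_morphism_on e c k"
  shows "sigma_morphism_on d c (k \<circ> h)"
  using sigma_morphism_onD[OF h] sigma_morphism_onD[OF k]
  unfolding sigma_morphism_on_def by simp

lemma sigma_morphism_on_partition:
  fixes c :: "nat \<Rightarrow> 'a::abstract_sigma_algebra"
  assumes disj: "\<And>i j. i \<le> n \<Longrightarrow> j \<le> n \<Longrightarrow> i \<noteq> j \<Longrightarrow> c i \<sqinter> c j = \<bottom>"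
    and top: "(SUP i\<in>{..n}. c i) = \<top>"
  shows "sigma_morphism_on {..n} \<top> (\<lambda>A. SUP i\<in>A. c i)"
proof -
  have compl: "(SUP i\<in>{..n} - A. c i) = - (SUP i\<in>A. c i)" if A: "A \<subseteq> {..n}" for A
  proof (rule compl_unique[symmetric])
    have "c j \<le> - (SUP i\<in>A. c i)" if j: "j \<in> {..n} - A" for j
    proof -
      have "(SUP i\<in>A. c i) \<le> - c j"
        using disj A j inf_shunt[of _ "c j"] by (intro ccSUP_least) fastforce+
      then show ?thesis using compl_le_swap1 by blast
    qed
    then have "(SUP i\<in>{..n} - A. c i) \<le> - (SUP i\<in>A. c i)"
      by (intro ccSUP_least) auto
    then show "(SUP i\<in>A. c i) \<sqinter> (SUP i\<in>{..n} - A. c i) = \<bottom>"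
      using inf_shunt[of "SUP i\<in>{..n} - A. c i" "SUP i\<in>A. c i"] by (simp add: inf.commute)
    have "c i \<le> (SUP i\<in>A. c i) \<squnion> (SUP i\<in>{..n} - A. c i)" if "i \<le> n" for i
    proof (cases "i \<in> A")
      case True
      then show ?thesis by (intro le_supI1 ccSUP_upper) auto
    next
      case False
      with that show ?thesis by (intro le_supI2 ccSUP_upper) auto
    qed
    then have "(SUP i\<in>{..n}. c i) \<le> (SUP i\<in>A. c i) \<squnion> (SUP i\<in>{..n} - A. c i)"
      by (intro ccSUP_least) auto
    then show "(SUP i\<in>A. c i) \<squnion> (SUP i\<in>{..n} - A. c i) = \<top>"
      by (simp add: top top_unique)
  qed
  have SUP: "(SUP i\<in>(\<Union>k. A k). c i) = (SUP k. SUP i\<in>A k. c i)" for A :: "nat \<Rightarrow> nat set"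
  proof (rule antisym)
    have "c i \<le> (SUP k. SUP i\<in>A k. c i)" if "i \<in> A k" for i k
    proof -
      have "c i \<le> (SUP i\<in>A k. c i)" using that by (intro ccSUP_upper) auto
      also have "\<dots> \<le> (SUP k. SUP i\<in>A k. c i)"
        by (rule ccSUP_upper[of UNIV _ "\<lambda>k. SUP i\<in>A k. c i"]) auto
      finally show ?thesis .
    qed
    then show "(SUP i\<in>(\<Union>k. A k). c i) \<le> (SUP k. SUP i\<in>A k. c i)"
      by (intro ccSUP_least) auto
    show "(SUP k. SUP i\<in>A k. c i) \<le> (SUP i\<in>(\<Union>k. A k). c i)"
      by (intro ccSUP_least) (auto intro!: ccSUP_upper)
  qed
  have mono: "(SUP i\<in>A. c i) \<le> (SUP i\<in>B. c i)" if "A \<subseteq> B" for A B :: "nat set"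
    using that by (intro ccSUP_least) (auto intro!: ccSUP_upper)
  show ?thesis
    unfolding sigma_morphism_on_def using compl SUP mono top
    by (auto simp: diff_eq)
qed

text \<open>
  The universal property of \<^typ>\<open>borel_alg\<close>, applied to the preimage map of \<open>x\<close>, gives a morphism
  into the power set of all of \<open>\<nat>\<close>; intersecting with \<open>{..n}\<close> restricts it to the first
  points.
\<close>

lemma ex_morphism_induced_by_points:
  obtains \<kappa> where "sigma_morphism_on \<top> {..n} \<kappa>" "induced_by_points n \<kappa> x"
proof -
  have "sigma_frame_morphism (\<lambda>U. {i :: nat. x i \<in> U})"
    unfolding sigma_frame_morphism_def by auto
  from borel_alg_universal[OF this] obtain \<psi> where
    \<psi>: "sigma_morphism_on \<top> \<top> \<psi>" and \<psi>_opn: "\<And>U. open U \<Longrightarrow> \<psi> (opn U) = {i. x i \<in> U}"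
    unfolding sigma_morphism_def by blast
  have "sigma_morphism_on \<top> {..n} (\<lambda>b. \<psi> b \<inter> {..n})"
    using sigma_morphism_onD[OF \<psi>] unfolding sigma_morphism_on_def by auto
  moreover have "induced_by_points n (\<lambda>b. \<psi> b \<inter> {..n}) x"
    unfolding induced_by_points_def using \<psi>_opn by auto
  ultimately show thesis by (rule that)
qed

lemma simple_fn_of_partition:
  fixes c :: "nat \<Rightarrow> 'a::abstract_sigma_algebra"
  assumes \<mu>: "sigma_measure \<mu>"
    and disj: "\<And>i j. i \<le> n \<Longrightarrow> j \<le> n \<Longrightarrow> i \<noteq> j \<Longrightarrow> c i \<sqinter> c j = \<bottom>"
    and top: "(SUP i\<in>{..n}. c i) = \<top>"
  obtains g where "simple_fn g" "simple_lint \<mu> g = (\<Sum>i\<le>n. \<mu> (c i) * x i)"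
    "\<And>U. open U \<Longrightarrow> g (opn U) = (SUP i\<in>{i \<in> {..n}. x i \<in> U}. c i)"
proof -
  obtain \<kappa> where \<kappa>: "sigma_morphism_on \<top> {..n} \<kappa>" "induced_by_points n \<kappa> x"
    by (rule ex_morphism_induced_by_points)
  define s where "s A = (SUP i\<in>A. c i)" for A
  have s: "sigma_morphism_on {..n} \<top> s"
    using sigma_morphism_on_partition[OF disj top] by (simp add: s_def[abs_def])
  have fact: "simple_factorization (s \<circ> \<kappa>) n \<kappa> s"
    unfolding simple_factorization_def using \<kappa> s by simp
  have simple: "simple_fn (s \<circ> \<kappa>)"
    unfolding simple_fn_def nonneg_measurable_def sigma_morphism_def
    using fact sigma_morphism_on_comp[OF \<kappa>(1) s] by blast
  show thesis
  proof (rule that[OF simple])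
    show "simple_lint \<mu> (s \<circ> \<kappa>) = (\<Sum>i\<le>n. \<mu> (c i) * x i)"
      using simple_lint_eq[OF \<mu> simple fact \<kappa>(2)] by (simp add: s_def)
    show "(s \<circ> \<kappa>) (opn U) = (SUP i\<in>{i \<in> {..n}. x i \<in> U}. c i)" if "open U" for U
      using \<kappa>(2) that by (simp add: induced_by_points_def s_def)
  qed
qed

section \<open>Superlevel elements\<close>

lemma nonneg_measurable_cl_upto:
  assumes "nonneg_measurable f"
  shows "f (cl_upto t) = - f (opn {t<..})"
  using assms sigma_morphism_onD(5)[of \<top> \<top> f "opn {t<..}"]
  by (simp add: cl_upto_def nonneg_measurable_def sigma_morphism_def diff_eq)

lemma meas_le_iff_opn:
  assumes "nonneg_measurable f" "nonneg_measurable g"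
  shows "meas_le f g \<longleftrightarrow> (\<forall>t. f (opn {t<..}) \<le> g (opn {t<..}))"
  by (simp add: meas_le_def nonneg_measurable_cl_upto assms)

lemma nonneg_measurable_opn_mono:
  assumes "nonneg_measurable f" "open U" "open V" "U \<subseteq> V"
  shows "f (opn U) \<le> f (opn V)"
  using assms opn_mono[OF assms(2-4)] sigma_morphism_onD(2)[of \<top> \<top> f]
  by (simp add: nonneg_measurable_def sigma_morphism_def)

lemma increases_to_opn:
  assumes F: "increases_to F f" "\<And>n. nonneg_measurable (F n)" and f: "nonneg_measurable f"
  shows "f (opn {t<..}) = (SUP n. F n (opn {t<..}))"
proof (rule antisym)
  have *: "F n (opn {t<..}) \<le> (SUP n. F n (opn {t<..}))" for n
    by (rule ccSUP_upper) auto
  have "- (SUP n. F n (opn {t<..})) \<le> (INF n. F n (cl_upto t))"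
    using * by (intro ccINF_greatest) (auto simp: nonneg_measurable_cl_upto F)
  also have "\<dots> = f (cl_upto t)"
    using F(1) by (simp only: increases_to_def)
  also have "\<dots> = - f (opn {t<..})"
    by (rule nonneg_measurable_cl_upto[OF f])
  finally show "f (opn {t<..}) \<le> (SUP n. F n (opn {t<..}))" by simp
  show "(SUP n. F n (opn {t<..})) \<le> f (opn {t<..})"
    using F meas_le_iff_opn[OF F(2) f]
    by (intro ccSUP_least) (auto simp: increases_to_def)
qed

section \<open>Monotone convergence\<close>

lemma lint_mono:
  assumes "meas_le f g"
  shows "lint \<mu> f \<le> lint \<mu> g"
proof -
  have "meas_le h g" if "meas_le h f" for h
    using that assms unfolding meas_le_def by (meson order_trans)
  then show ?thesis unfolding lint_def by (intro Sup_subset_mono) auto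
qed

text \<open>
  The hypothesis \<open>le\<close> says that \<open>h \<ge> y i\<close> on \<open>b i\<close>. The \<open>b i\<close> may fail to cover the
  whole space, so the complement of their join is added as a last piece with value \<open>0\<close>, which
  changes neither the sum nor the superlevel elements.
\<close>

lemma sum_le_lint:
  fixes b :: "nat \<Rightarrow> 'a::abstract_sigma_algebra"
  assumes \<mu>: "sigma_measure \<mu>" and h: "nonneg_measurable h"
    and disj: "\<And>i j. i \<le> n \<Longrightarrow> j \<le> n \<Longrightarrow> i \<noteq> j \<Longrightarrow> b i \<sqinter> b j = \<bottom>"
    and le: "\<And>i t. i \<le> n \<Longrightarrow> t < y i \<Longrightarrow> b i \<le> h (opn {t<..})"
  shows "(\<Sum>i\<le>n. \<mu> (b i) * y i) \<le> lint \<mu> h"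
proof -
  define B where "B = (SUP i\<in>{..n}. b i)"
  define c where "c i = (if i \<le> n then b i else - B)" for i
  define x where "x i = (if i \<le> n then y i else 0)" for i
  have b_le: "b i \<le> B" if "i \<le> n" for i
    unfolding B_def using that by (intro ccSUP_upper) auto
  have bB: "b i \<sqinter> - B = \<bottom>" if "i \<le> n" for i
    using b_le[OF that] inf_shunt[of "b i" "- B"] by simp
  have c_disj: "c i \<sqinter> c j = \<bottom>" if "i \<le> Suc n" "j \<le> Suc n" "i \<noteq> j" for i j
    using that disj bB by (auto simp: c_def inf.commute)
  have c_le: "c i \<le> (SUP i\<in>{..Suc n}. c i)" if "i \<le> Suc n" for i
    using that by (intro ccSUP_upper) auto
  have "B \<le> (SUP i\<in>{..Suc n}. c i)"
    unfolding B_def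
  proof (intro ccSUP_least)
    fix i assume "i \<in> {..n}"
    then show "b i \<le> (SUP i\<in>{..Suc n}. c i)" using c_le[of i] by (simp add: c_def)
  qed auto
  moreover have "- B \<le> (SUP i\<in>{..Suc n}. c i)"
    using c_le[of "Suc n"] by (simp add: c_def)
  ultimately have "B \<squnion> - B \<le> (SUP i\<in>{..Suc n}. c i)" by (rule le_supI)
  then have c_top: "(SUP i\<in>{..Suc n}. c i) = \<top>"
    unfolding sup_compl_top by (rule top_le)
  obtain g where g: "simple_fn g" "simple_lint \<mu> g = (\<Sum>i\<le>Suc n. \<mu> (c i) * x i)"
    "\<And>U. open U \<Longrightarrow> g (opn U) = (SUP i\<in>{i \<in> {..Suc n}. x i \<in> U}. c i)"
  proof (rule simple_fn_of_partition[where x = x, OF \<mu> _ c_top])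
    show "c i \<sqinter> c j = \<bottom>" if "i \<le> Suc n" "j \<le> Suc n" "i \<noteq> j" for i j
      using that by (rule c_disj)
  qed (rule that, simp_all)
  have "g (opn {t<..}) \<le> h (opn {t<..})" for t
    unfolding g(3)[OF open_greaterThan]
  proof (intro ccSUP_least)
    fix i assume "i \<in> {i \<in> {..Suc n}. x i \<in> {t<..}}"
    then show "c i \<le> h (opn {t<..})"
      using le[of i t] by (auto simp: c_def x_def split: if_splits)
  qed auto
  then have "meas_le g h"
    using g(1) h by (simp add: meas_le_iff_opn simple_fn_def)
  then have "simple_lint \<mu> g \<le> lint \<mu> h"
    unfolding lint_def using g(1) by (intro Sup_upper) blast
  moreover have "simple_lint \<mu> g = (\<Sum>i\<le>n. \<mu> (b i) * y i)"
    by (simp add: g(2) c_def x_def)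
  ultimately show ?thesis by simp
qed

lemma incseq_below_ennreal:
  fixes x :: ennreal
  obtains u :: "nat \<Rightarrow> ennreal"
    where "incseq u" "(SUP k. u k) = x" "\<And>k. u k < x \<or> u k = 0"
proof (cases "x = 0")
  case True
  show thesis by (rule that[of "\<lambda>_. 0"]) (auto simp: True)
next
  case False
  then have "0 \<in> {..<x}" by (simp add: zero_less_iff_neq_zero)
  then have "{..<x} \<noteq> {}" by blast
  from ennreal_Sup_countable_SUP[OF this] obtain u :: "nat \<Rightarrow> ennreal"
    where "incseq u" "range u \<subseteq> {..<x}" "Sup {..<x} = (SUP k. u k)" by blast
  moreover have "Sup {..<x} = x"
    by (rule Sup_lessThan)
  ultimately show thesis by (intro that[of u]) auto
qed

text \<open>
  The step in which \<open>k\<close> grows while the lowered values \<open>y\<close> stay fixed. An index with \<open>y i = 0\<close>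
  contributes nothing, which is why the pieces of \<open>a i\<close> need not increase to \<open>a i\<close> there.
\<close>

lemma sum_le_SUP_lint:
  fixes a :: "nat \<Rightarrow> 'a::abstract_sigma_algebra"
  assumes \<mu>: "sigma_measure \<mu>" and f: "nonneg_measurable f" and F: "\<And>k. nonneg_measurable (F k)"
    and inc: "increases_to F f"
    and disj: "\<And>i j. i \<le> n \<Longrightarrow> j \<le> n \<Longrightarrow> i \<noteq> j \<Longrightarrow> a i \<sqinter> a j = \<bottom>"
    and le: "\<And>i. i \<le> n \<Longrightarrow> y i = 0 \<or> a i \<le> f (opn {y i<..})"
  shows "(\<Sum>i\<le>n. \<mu> (a i) * y i) \<le> (SUP k. lint \<mu> (F k))"
proof -
  define b where "b k i = a i \<sqinter> F k (opn {y i<..})" for k i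
  have b_inc: "incseq (\<lambda>k. b k i)" for i
    unfolding b_def
    using inc F by (intro incseq_SucI inf_mono) (auto simp: increases_to_def meas_le_iff_opn)
  have \<mu>b: "\<mu> (SUP k. b k i) = (SUP k. \<mu> (b k i))" for i
    by (rule measure_SUP_incseq[OF \<mu> b_inc])
  have term_eq: "\<mu> (a i) * y i = (SUP k. \<mu> (b k i) * y i)" if "i \<le> n" for i
  proof (cases "y i = 0")
    case False
    with le[OF that] have "a i = a i \<sqinter> f (opn {y i<..})" by (simp add: inf_absorb1)
    also have "\<dots> = (SUP k. b k i)"
      by (simp only: increases_to_opn[OF inc F f] inf_SUP_nat b_def)
    finally show ?thesis
      using \<mu>b[of i] by (simp add: SUP_mult_right_ennreal)
  qed simp
  have "(\<Sum>i\<le>n. \<mu> (a i) * y i) = (\<Sum>i\<le>n. SUP k. \<mu> (b k i) * y i)"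
    by (intro sum.cong) (auto simp: term_eq)
  also have "\<dots> = (SUP k. \<Sum>i\<le>n. \<mu> (b k i) * y i)"
    by (intro ennreal_SUP_sum[symmetric] incseq_def[THEN iffD2]) (auto intro!: mult_right_mono measure_mono[OF \<mu>] incseqD[OF b_inc])
  also have "\<dots> \<le> (SUP k. lint \<mu> (F k))"
  proof (intro SUP_mono bexI)
    fix k :: nat
    show "(\<Sum>i\<le>n. \<mu> (b k i) * y i) \<le> lint \<mu> (F k)"
    proof (rule sum_le_lint[OF \<mu> F])
      show "b k i \<sqinter> b k j = \<bottom>" if "i \<le> n" "j \<le> n" "i \<noteq> j" for i j
      proof -
        have "b k i \<sqinter> b k j \<le> a i \<sqinter> a j" unfolding b_def by (intro inf_mono) auto
        with disj[OF that] show ?thesis by (simp add: bot_unique)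
      qed
      show "b k i \<le> F k (opn {t<..})" if "t < y i" for i t
      proof -
        have "F k (opn {y i<..}) \<le> F k (opn {t<..})"
          using that by (intro nonneg_measurable_opn_mono[OF F]) auto
        then show ?thesis unfolding b_def by (rule le_infI2)
      qed
    qed
  qed auto
  finally show ?thesis .
qed

lemma simple_lint_le_SUP_lint:
  assumes \<mu>: "sigma_measure \<mu>" and f: "nonneg_measurable f" and F: "\<And>k. nonneg_measurable (F k)"
    and inc: "increases_to F f" and g: "simple_fn g" and gf: "meas_le g f"
  shows "simple_lint \<mu> g \<le> (SUP k. lint \<mu> (F k))"
proof -
  from g obtain n \<kappa> s where fact: "simple_factorization g n \<kappa> s"
    unfolding simple_fn_def by blast
  then obtain x where x: "induced_by_points n \<kappa> x"
    using factorization_induced_by_points by blast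
  from fact have s: "sigma_morphism_on {..n} \<top> s" and g_eq: "g = s \<circ> \<kappa>"
    by (auto simp: simple_factorization_def)
  have disj: "s {i} \<sqinter> s {j} = \<bottom>" if "i \<le> n" "j \<le> n" "i \<noteq> j" for i j
    using sigma_morphism_on_inf[OF s, of "{i}" "{j}"] sigma_morphism_onD(3)[OF s] that by simp
  have le: "s {i} \<le> f (opn {t<..})" if "i \<le> n" "t < x i" for i t
  proof -
    have "s {i} \<le> s (\<kappa> (opn {t<..}))"
      using x that by (intro sigma_morphism_onD(2)[OF s]) (auto simp: induced_by_points_def)
    also have "\<dots> \<le> f (opn {t<..})"
      using gf g f by (simp add: meas_le_iff_opn simple_fn_def flip: g_eq[THEN fun_cong, simplified])
    finally show ?thesis .
  qed
  have "\<exists>u. incseq u \<and> (SUP k. u k) = x i \<and> (\<forall>k. u k < x i \<or> u k = 0)" for i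
    by (rule incseq_below_ennreal[of "x i"]) blast
  then obtain u where u: "\<And>i. incseq (u i)" "\<And>i. (SUP k. u i k) = x i"
      "\<And>i k. u i k < x i \<or> u i k = 0"
    by metis
  have "simple_lint \<mu> g = (\<Sum>i\<le>n. \<mu> (s {i}) * x i)"
    by (rule simple_lint_eq[OF \<mu> g fact x])
  also have "\<dots> = (\<Sum>i\<le>n. SUP k. \<mu> (s {i}) * u i k)"
    by (simp add: u(2)[symmetric] SUP_mult_left_ennreal)
  also have "\<dots> = (SUP k. \<Sum>i\<le>n. \<mu> (s {i}) * u i k)"
    using u(1) by (intro ennreal_SUP_sum[symmetric]) (auto simp: incseq_def intro!: mult_left_mono)
  also have "\<dots> \<le> (SUP k. lint \<mu> (F k))"
  proof (rule SUP_least)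
    fix k
    show "(\<Sum>i\<le>n. \<mu> (s {i}) * u i k) \<le> (SUP k. lint \<mu> (F k))"
      using disj le u(3) by (intro sum_le_SUP_lint[OF \<mu> f F inc]) blast+
  qed
  finally show ?thesis .
qed

theorem theorem7:
  fixes \<mu> :: "'a::abstract_sigma_algebra \<Rightarrow> ennreal"
    and f :: "borel_alg \<Rightarrow> 'a"
    and F :: "nat \<Rightarrow> borel_alg \<Rightarrow> 'a"
  assumes "sigma_measure \<mu>"
    and "nonneg_measurable f"
    and "\<And>n. nonneg_measurable (F n)"
    and "increases_to F f"
  shows "(\<lambda>n. lint \<mu> (F n)) \<longlonglongrightarrow> lint \<mu> f"
proof -
  have "incseq (\<lambda>n. lint \<mu> (F n))"
    using assms(4) by (intro incseq_SucI lint_mono) (auto simp: increases_to_def)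
  then have "(\<lambda>n. lint \<mu> (F n)) \<longlonglongrightarrow> (SUP n. lint \<mu> (F n))"
    by (rule LIMSEQ_SUP)
  moreover have "(SUP n. lint \<mu> (F n)) = lint \<mu> f"
  proof (rule antisym)
    show "(SUP n. lint \<mu> (F n)) \<le> lint \<mu> f"
      using assms(4) by (intro SUP_least lint_mono) (auto simp: increases_to_def)
    show "lint \<mu> f \<le> (SUP n. lint \<mu> (F n))"
      unfolding lint_def[of \<mu> f]
      using simple_lint_le_SUP_lint[OF assms] by (intro Sup_least) blast
  qed
  ultimately show ?thesis by simp
qed

end
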